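(* For every integer $n\geq 4$ and every $i\in[n]$, the following hold: \begin{align*} |\mathrm{VPF}_n|&= \sum_{i=1}^n|\mathrm{VPF}_{n,i}|,\\ |\mathrm{VPF}_{n,i}|&= |\mathrm{VPF}_{n,(i)}|+|\mathrm{VPF}_{n,[i]}|,\\ |\mathrm{VPF}_{n,(i)}|&= |\mathrm{VPF}_{n-1}|+(n-i)|\mathrm{VPF}_{n-2}|+\sum_{\ell=i}^{n-2}(\ell+1-i)|\mathrm{VPF}_{n-2, (\ell)}|,\\ |\mathrm{VPF}_{n,[i]}|&= \frac{(i-1)(i-2)}{2}|\mathrm{VPF}_{n-3}|+\sum_{\ell=1}^{i-1}|\mathrm{VPF}_{n-1,[\ell]}|+(i-1)\sum_{\ell=1}^{i-2}|\mathrm{VPF}_{n-2,\ell}|\\ &\qquad+\sum_{\ell=1}^{i-3}\frac{\ell(\ell+1)}{2}|\mathrm{VPF}_{n-3, (\ell)}|+\frac{(i-2)(i-1)}{2}\sum_{\ell=i-2}^{n-3}|\mathrm{VPF}_{n-3, (\ell)}|, \end{align*} (empty sums being $0$), with initial values $|\mathrm{VPF}_{1, (1)}|=|\mathrm{VPF}_{2, (2)}|=1$, $|\mathrm{VPF}_{2, (1)}|=2$, $|\mathrm{VPF}_{3, (1)}|=7$, $|\mathrm{VPF}_{3, (2)}|=5$, $|\mathrm{VPF}_{3, (3)}|=4$, and $|\mathrm{VPF}_{1, [1]}|=|\mathrm{VPF}_{2, [1]}|=|\mathrm{VPF}_{3, [1]}|=|\mathrm{VPF}_{3, [2]}|=0$,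 $|\mathrm{VPF}_{2, [2]}|=1$, $|\mathrm{VPF}_{3, [3]}|=4$.
   Context: For $n\in\mathbb{N}$ let $[n]=\{1,\dots,n\}$. A preference list $\alpha=(a_1,\dots,a_n)\in[n]^n$ describes $n$ cars entering, in order $i=1,\dots,n$, a one-way street with spots $1,\dots,n$; car $i$ prefers spot $a_i$. Under the (1-)vacillating parking rule, car $i$ parks in spot $a_i$ if unoccupied; otherwise in spot $a_i-1$ if it exists and is unoccupied; otherwise in spot $a_i+1$ if it exists and is unoccupied; otherwise it fails to park. If all cars park, $\alpha$ is a vacillating parking function of length $n$; $\mathrm{VPF}_n$ is the set of these. For $i\in[n]$: $\mathrm{VPF}_{n,i}$ is the set of $\alpha\in\mathrm{VPF}_n$ in which spot $n$ is occupied by car $i$; $\mathrm{VPF}_{n,(i)}$ is the set of $\alpha\in\mathrm{VPF}_n$ in which car $i$ prefers spot $n$ and parks in spot $n$; $\mathrm{VPF}_{n,[i]}$ is the set of $\alpha\in\mathrm{VPF}_n$ in which car $i$ prefers spot $n-1$ and parks in spot $n$. *)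

theory Defs
  imports Complex_Main
begin

text \<open>
  Cars and spots are numbered from 1, lists from 0: for a preference list \<open>\<alpha>\<close>, car \<open>i\<close> prefers
  spot \<open>\<alpha> ! (i - 1)\<close>, and in an outcome \<open>ps\<close> it parks in spot \<open>ps ! (i - 1)\<close>.
\<close>

definition pref_lists :: "nat \<Rightarrow> nat list set" where
  "pref_lists n = {\<alpha>. length \<alpha> = n \<and> set \<alpha> \<subseteq> {1..n}}"

text \<open>The spot taken by a car preferring \<open>a\<close> when the spots in \<open>S\<close> are occupied;
  \<open>None\<close> if the car fails to park.\<close>

definition vacillating_spot :: "nat \<Rightarrow> nat set \<Rightarrow> nat \<Rightarrow> nat option" where
  "vacillating_spot n S a =
     (if a \<notin> S then Some a
      else if 1 \<le> a - 1 \<and> a - 1 \<notin> S then Some (a - 1)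
      else if a + 1 \<le> n \<and> a + 1 \<notin> S then Some (a + 1)
      else None)"

text \<open>The spots taken by successive cars, starting with the spots in \<open>S\<close> occupied;
  \<open>None\<close> as soon as one car fails to park.\<close>

primrec park_from :: "nat \<Rightarrow> nat set \<Rightarrow> nat list \<Rightarrow> nat list option" where
  "park_from n S [] = Some []"
| "park_from n S (a # as) =
     (case vacillating_spot n S a of
        None \<Rightarrow> None
      | Some s \<Rightarrow> map_option (\<lambda>ps. s # ps) (park_from n (insert s S) as))"

definition outcome :: "nat \<Rightarrow> nat list \<Rightarrow> nat list option" where
  "outcome n \<alpha> = park_from n {} \<alpha>"

definition VPF :: "nat \<Rightarrow> nat list set" where
  "VPF n = {\<alpha> \<in> pref_lists n. outcome n \<alpha> \<noteq> None}"

definition parking_spot :: "nat \<Rightarrow> nat list \<Rightarrow> nat \<Rightarrow> nat" where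
  "parking_spot n \<alpha> i = the (outcome n \<alpha>) ! (i - 1)"

text \<open>The sets written $\mathrm{VPF}_{n,i}$, $\mathrm{VPF}_{n,(i)}$ and $\mathrm{VPF}_{n,[i]}$,
  in this order; only indices \<open>1 \<le> i \<le> n\<close> are meaningful.\<close>

definition VPF_last :: "nat \<Rightarrow> nat \<Rightarrow> nat list set" where
  "VPF_last n i = {\<alpha> \<in> VPF n. parking_spot n \<alpha> i = n}"

definition VPF_round :: "nat \<Rightarrow> nat \<Rightarrow> nat list set" where
  "VPF_round n i = {\<alpha> \<in> VPF n. \<alpha> ! (i - 1) = n \<and> parking_spot n \<alpha> i = n}"

definition VPF_square :: "nat \<Rightarrow> nat \<Rightarrow> nat list set" where
  "VPF_square n i = {\<alpha> \<in> VPF n. \<alpha> ! (i - 1) = n - 1 \<and> parking_spot n \<alpha> i = n}"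

end

theory Submission
  imports Defs "HOL-Combinatorics.Multiset_Permutations"
begin

text \<open>
  Fix which car \<open>c s\<close> ends up in each spot \<open>s\<close>. The preferences producing this outcome can be
  chosen independently: the car in spot \<open>s\<close> may prefer \<open>s\<close>; it may prefer \<open>s + 1\<close> iff
  \<open>c (s + 1) < c s\<close>; and it may prefer \<open>s - 1\<close> iff \<open>c (s - 1) < c s\<close> and (\<open>s = 2\<close> or
  \<open>c (s - 2) < c s\<close>). So all cardinalities are sums of products of weights over permutations, and
  one recurses by deleting the last spot and renumbering the cars. Deleting spot \<open>n\<close>, occupied by
  car \<open>i\<close>, only affects the term for the preference \<open>n\<close> of the car in spot \<open>n - 1\<close>, which gives
  $|\mathrm{VPF}_{n,(i)}| = |\mathrm{VPF}_{n-1}| + \sum_{j=i}^{n-1} |\mathrm{VPF}_{n-1,(j)}|$.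
  For $\mathrm{VPF}_{n,[i]}$ the cars in spots \<open>n - 1\<close> and \<open>n - 2\<close> both precede \<open>i\<close>; splitting
  by how the car in spot \<open>n - 1\<close> got there and deleting that spot as well gives
  $|\mathrm{VPF}_{n,[i]}| = \sum_{j<i} |\mathrm{VPF}_{n-1,[j]}| + (i-1) \sum_{l\le i-2}
  |\mathrm{VPF}_{n-2,l}| + \sum_{l\le i-2} l\,|\mathrm{VPF}_{n-2,(l)}|$.
  Applying the first recursion once more inside each formula yields the stated ones.
\<close>

section \<open>Preference lists with a given outcome\<close>

lemma mem_listset_iff: "xs \<in> listset As \<longleftrightarrow> list_all2 (\<in>) xs As"
  by (induction As arbitrary: xs) (auto simp: set_Cons_def list_all2_Cons2)

lemma finite_listset:
  assumes "\<And>A. A \<in> set As \<Longrightarrow> finite A"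
  shows "finite (listset As)"
  using assms
proof (induction As)
  case (Cons A As)
  have "listset (A # As) = (\<lambda>(x, xs). x # xs) ` (A \<times> listset As)"
    by (auto simp: set_Cons_def)
  with Cons show ?case by simp
qed simp

lemma card_listset: "card (listset As) = prod_list (map card As)"
proof (induction As)
  case (Cons A As)
  have "listset (A # As) = (\<lambda>(x, xs). x # xs) ` (A \<times> listset As)"
    by (auto simp: set_Cons_def)
  moreover have "inj_on (\<lambda>(x, xs). x # xs) (A \<times> listset As)"
    by (auto simp: inj_on_def)
  ultimately show ?case
    using Cons by (simp add: card_image card_cartesian_product)
qed simp

lemma vacillating_spot_SomeD:
  assumes "vacillating_spot n S a = Some s" "a \<in> {1..n}"
  shows "s \<in> {1..n} - S"
  using assms by (auto simp: vacillating_spot_def split: if_splits)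

text \<open>Unrolling the recursion gives one condition per car: when the car at position
  \<open>k\<close> arrives, the occupied spots are \<open>S\<close> and the first \<open>k\<close>
  entries of \<open>ps\<close>. For fixed \<open>ps\<close> these conditions do not involve each
  other's preferences.\<close>

lemma park_from_eq_Some_iff:
  "park_from n S as = Some ps \<longleftrightarrow>
     length ps = length as \<and>
     (\<forall>k<length as. vacillating_spot n (S \<union> set (take k ps)) (as ! k) = Some (ps ! k))"
proof (induction as arbitrary: S ps)
  case (Cons a as)
  show ?case
  proof (cases ps)
    case (Cons p ps')
    have "park_from n S (a # as) = Some ps \<longleftrightarrow>
        vacillating_spot n S a = Some p \<and> park_from n (insert p S) as = Some ps'"
      by (auto simp: Cons split: option.splits)
    then show ?thesis
      by (simp add: Cons.IH Cons All_less_Suc2 del: park_from.simps) auto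
  qed (simp split: option.splits)
qed auto

text \<open>The choices open to a single car once the whole outcome \<open>ps\<close> is prescribed;
  \<open>k\<close> counts cars from 0.\<close>

definition spot_prefs :: "nat \<Rightarrow> nat list \<Rightarrow> nat \<Rightarrow> nat set" where
  "spot_prefs n ps k = {a \<in> {1..n}. vacillating_spot n (set (take k ps)) a = Some (ps ! k)}"

lemma finite_spot_prefs [simp]: "finite (spot_prefs n ps k)"
  by (simp add: spot_prefs_def)

text \<open>This is the independence of choices: the preference lists with a given outcome form a
  Cartesian product.\<close>

lemma outcome_eq_Some_iff:
  assumes "length \<alpha> = n"
  shows "\<alpha> \<in> pref_lists n \<and> outcome n \<alpha> = Some ps \<longleftrightarrow>
     length ps = n \<and> (\<forall>k<n. \<alpha> ! k \<in> spot_prefs n ps k)"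
  using assms unfolding pref_lists_def outcome_def park_from_eq_Some_iff spot_prefs_def
  by (auto simp: set_conv_nth subset_iff)

text \<open>Each car parks in a spot of \<open>{1..n}\<close> not taken before, so the
  \<open>n\<close> entries of \<open>ps\<close> are distinct and exhaust
  \<open>{1..n}\<close>.\<close>

lemma outcome_permutation:
  assumes "\<alpha> \<in> pref_lists n" "outcome n \<alpha> = Some ps"
  shows "ps \<in> permutations_of_set {1..n}"
proof -
  have len: "length \<alpha> = n" using assms by (simp add: pref_lists_def)
  with assms have lps: "length ps = n" and p: "\<And>k. k < n \<Longrightarrow> \<alpha> ! k \<in> spot_prefs n ps k"
    using outcome_eq_Some_iff[OF len] by auto
  have new: "ps ! k \<in> {1..n} - set (take k ps)" if "k < n" for k
    using p[OF that] vacillating_spot_SomeD unfolding spot_prefs_def by blast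
  have ne: "ps ! j \<noteq> ps ! k" if "j < k" "k < n" for j k
  proof -
    have "ps ! j \<in> set (take k ps)" using that lps by (auto simp: in_set_conv_nth)
    with new[OF that(2)] show ?thesis by auto
  qed
  have dist: "distinct ps" unfolding distinct_conv_nth lps by (metis ne linorder_neqE_nat)
  have "set ps \<subseteq> {1..n}" using new lps by (auto simp: set_conv_nth)
  moreover have "card (set ps) = card {1..n}" using dist lps by (simp add: distinct_card)
  ultimately have "set ps = {1..n}" by (intro card_subset_eq) auto
  with dist show ?thesis by (simp add: permutations_of_set_def)
qed

text \<open>The set is the disjoint union, over outcomes placing car \<open>i\<close> in spot
  \<open>n\<close>, of products of choice sets. The parameter \<open>C\<close> restricts the
  preference of car \<open>i\<close>, so that one count serves all three families.\<close>

lemma card_VPF_restricted: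
  assumes i: "i \<in> {1..n}"
  shows "card {\<alpha> \<in> VPF n. \<alpha> ! (i - 1) \<in> C \<and> parking_spot n \<alpha> i = n} =
    (\<Sum>ps \<in> {ps \<in> permutations_of_set {1..n}. ps ! (i - 1) = n}.
       \<Prod>k<n. card (if k = i - 1 then spot_prefs n ps k \<inter> C else spot_prefs n ps k))"
proof -
  define B where "B ps k = (if k = i - 1 then spot_prefs n ps k \<inter> C else spot_prefs n ps k)" for ps k
  define P where "P = {ps \<in> permutations_of_set {1..n}. ps ! (i - 1) = n}"
  define F where "F ps = listset (map (B ps) [0..<n])" for ps
  have F: "\<alpha> \<in> F ps \<longleftrightarrow> \<alpha> \<in> pref_lists n \<and> outcome n \<alpha> = Some ps \<and> \<alpha> ! (i - 1) \<in> C"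
    if "ps \<in> P" for \<alpha> ps
  proof -
    have lps: "length ps = n" using that length_finite_permutations_of_set[of ps "{1..n}"]
      by (simp add: P_def)
    have "\<alpha> \<in> F ps \<longleftrightarrow> length \<alpha> = n \<and> (\<forall>k<n. \<alpha> ! k \<in> B ps k)"
      by (auto simp: F_def mem_listset_iff list_all2_conv_all_nth)
    also have "\<dots> \<longleftrightarrow> length \<alpha> = n \<and> (\<forall>k<n. \<alpha> ! k \<in> spot_prefs n ps k) \<and> \<alpha> ! (i - 1) \<in> C"
      using i by (auto simp: B_def split: if_splits)
    also have "\<dots> \<longleftrightarrow> \<alpha> \<in> pref_lists n \<and> outcome n \<alpha> = Some ps \<and> \<alpha> ! (i - 1) \<in> C"
      using outcome_eq_Some_iff[of \<alpha> n ps] lps by (auto simp: pref_lists_def)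
    finally show ?thesis .
  qed
  have "{\<alpha> \<in> VPF n. \<alpha> ! (i - 1) \<in> C \<and> parking_spot n \<alpha> i = n} = (\<Union>ps\<in>P. F ps)"
  proof (intro set_eqI iffI)
    fix \<alpha> assume "\<alpha> \<in> {\<alpha> \<in> VPF n. \<alpha> ! (i - 1) \<in> C \<and> parking_spot n \<alpha> i = n}"
    then obtain ps where *: "\<alpha> \<in> pref_lists n" "outcome n \<alpha> = Some ps" "\<alpha> ! (i - 1) \<in> C" "ps ! (i - 1) = n"
      by (auto simp: VPF_def parking_spot_def)
    then have "ps \<in> P" using outcome_permutation by (auto simp: P_def)
    with * F show "\<alpha> \<in> (\<Union>ps\<in>P. F ps)" by blast
  next
    fix \<alpha> assume "\<alpha> \<in> (\<Union>ps\<in>P. F ps)"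
    then obtain ps where "ps \<in> P" "\<alpha> \<in> F ps" by blast
    with F[of ps \<alpha>] show "\<alpha> \<in> {\<alpha> \<in> VPF n. \<alpha> ! (i - 1) \<in> C \<and> parking_spot n \<alpha> i = n}"
      by (auto simp: VPF_def parking_spot_def P_def)
  qed
  also have "card \<dots> = (\<Sum>ps\<in>P. card (F ps))"
  proof (rule card_UN_disjoint)
    show "finite P" by (simp add: P_def)
    show "\<forall>ps\<in>P. finite (F ps)" by (auto simp: F_def B_def intro!: finite_listset)
    show "\<forall>ps\<in>P. \<forall>qs\<in>P. ps \<noteq> qs \<longrightarrow> F ps \<inter> F qs = {}" using F by auto
  qed
  also have "\<dots> = (\<Sum>ps\<in>P. \<Prod>k<n. card (B ps k))"
    by (simp add: F_def card_listset comp_def atLeast0LessThan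
      flip: prod.distinct_set_conv_list)
  finally show ?thesis by (simp add: P_def B_def)
qed

section \<open>Weights of permutations\<close>

text \<open>
  A permutation is read from the last spot to the first, so that deleting the last spot means taking
  the tail. \<open>forward_step x xs\<close> says that car \<open>x\<close> can prefer the spot before its own, when \<open>xs\<close> lists
  the cars in the earlier spots; in \<open>weight y xs\<close>, car \<open>y\<close> is in the spot after those of \<open>xs\<close>, and
  a \<open>y\<close> exceeding all cars stands for the end of the street.
\<close>

fun forward_step :: "nat \<Rightarrow> nat list \<Rightarrow> bool" where
  "forward_step x [] = False"
| "forward_step x [a] = (a < x)"
| "forward_step x (a # b # cs) = (a < x \<and> b < x)"

primrec weight :: "nat \<Rightarrow> nat list \<Rightarrow> nat" where
  "weight y [] = 1"
| "weight y (x # xs) = (1 + of_bool (y < x) + of_bool (forward_step x xs)) * weight x xs"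

lemma forward_step_map_rev:
  "forward_step x (map c (rev [1..<Suc m])) \<longleftrightarrow> 1 \<le> m \<and> c m < x \<and> (m = 1 \<or> c (m - 1) < x)"
proof (cases m)
  case (Suc k)
  then show ?thesis by (cases k) auto
qed simp

text \<open>Rewrites the recursive weight as a product over spots, with \<open>y\<close> in the role
  of the car in spot \<open>m + 1\<close>. Splitting off spot \<open>Suc m\<close> makes its car
  \<open>c (Suc m)\<close> the boundary value for the remaining spots, which drives the
  induction.\<close>

lemma weight_map_rev:
  "weight y (map c (rev [1..<Suc m])) =
     (\<Prod>s=1..m. 1 + of_bool ((if s = m then y else c (s + 1)) < c s) +
        of_bool (2 \<le> s \<and> c (s - 1) < c s \<and> (s = 2 \<or> c (s - 2) < c s)))"
proof (induction m arbitrary: y)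
  case (Suc m)
  define B where "B s \<longleftrightarrow> 2 \<le> s \<and> c (s - 1) < c s \<and> (s = 2 \<or> c (s - 2) < c s)" for s
  define f where "f z k s = 1 + of_bool ((if s = k then z else c (s + 1)) < c s) + (of_bool (B s) :: nat)"
    for z k s
  have B: "forward_step (c (Suc m)) (map c (rev [1..<Suc m])) \<longleftrightarrow> B (Suc m)"
    unfolding forward_step_map_rev B_def by auto
  have "rev [1..<Suc (Suc m)] = Suc m # rev [1..<Suc m]" by simp
  then have "weight y (map c (rev [1..<Suc (Suc m)])) =
      f y (Suc m) (Suc m) * weight (c (Suc m)) (map c (rev [1..<Suc m]))"
    using B by (simp add: f_def del: upt_Suc)
  also have "weight (c (Suc m)) (map c (rev [1..<Suc m])) = (\<Prod>s=1..m. f (c (Suc m)) m s)"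
    unfolding f_def B_def by (rule Suc.IH)
  also have "\<dots> = (\<Prod>s=1..m. f y (Suc m) s)"
    by (rule prod.cong) (auto simp: f_def)
  also have "f y (Suc m) (Suc m) * \<dots> = (\<Prod>s=1..Suc m. f y (Suc m) s)"
    by (simp add: mult.commute)
  finally show ?case unfolding f_def B_def .
qed simp

text \<open>The inverse of the outcome: \<open>ps\<close> gives spots by car from position 0, while
  \<open>car_at\<close> gives cars by spot, numbered from 1.\<close>

definition car_at :: "nat \<Rightarrow> nat list \<Rightarrow> nat \<Rightarrow> nat" where
  "car_at n ps s = Suc (inv_into {..<n} ((!) ps) s)"

definition car_word :: "nat \<Rightarrow> nat list \<Rightarrow> nat list" where
  "car_word n ps = map (car_at n ps) (rev [1..<Suc n])"

context
  fixes n :: nat and ps :: "nat list"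
  assumes ps: "ps \<in> permutations_of_set {1..n}"
begin

lemma bij_nth: "bij_betw ((!) ps) {..<n} {1..n}"
  using bij_betw_nth[of ps "{..<n}" "{1..n}"] permutations_of_setD[OF ps]
    length_finite_permutations_of_set[OF ps] by simp

lemma car_at_nth: "k < n \<Longrightarrow> car_at n ps (ps ! k) = Suc k"
  unfolding car_at_def using bij_nth by (simp add: bij_betw_def)

lemma bij_car_at: "bij_betw (car_at n ps) {1..n} {1..n}"
proof -
  have "bij_betw Suc {..<n} {1..n}" by (auto simp: bij_betw_def image_Suc_lessThan)
  from bij_betw_trans[OF bij_betw_inv_into[OF bij_nth] this] show ?thesis
    by (simp add: comp_def car_at_def[abs_def])
qed

lemma car_at_bounds: "s \<in> {1..n} \<Longrightarrow> 1 \<le> car_at n ps s \<and> car_at n ps s \<le> n"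
  using bij_car_at by (auto simp: bij_betw_def)

lemma nth_car_at: "s \<in> {1..n} \<Longrightarrow> ps ! (car_at n ps s - 1) = s"
  unfolding car_at_def using bij_betw_inv_into_right[OF bij_nth] by simp

text \<open>Turns "occupied before a car arrives" into a comparison of car numbers.\<close>

lemma mem_take_iff:
  assumes "k \<le> n"
  shows "t \<in> set (take k ps) \<longleftrightarrow> t \<in> {1..n} \<and> car_at n ps t \<le> k"
proof
  assume "t \<in> set (take k ps)"
  then obtain j where "j < k" "j < n" "t = ps ! j"
    using assms length_finite_permutations_of_set[OF ps] by (auto simp: in_set_conv_nth)
  moreover from this have "t \<in> {1..n}" using bij_nth by (auto simp: bij_betw_def)
  ultimately show "t \<in> {1..n} \<and> car_at n ps t \<le> k" by (simp add: car_at_nth)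
next
  assume *: "t \<in> {1..n} \<and> car_at n ps t \<le> k"
  then have "car_at n ps t - 1 < k" "ps ! (car_at n ps t - 1) = t"
    using car_at_bounds[of t] nth_car_at by auto
  then show "t \<in> set (take k ps)"
    using assms length_finite_permutations_of_set[OF ps] by (auto simp: in_set_conv_nth)
qed

text \<open>A car ends in \<open>s\<close> by preferring \<open>s\<close>, by backing up from an
  occupied \<open>s + 1\<close>, or by moving on from an occupied \<open>s - 1\<close> when
  \<open>s - 2\<close> is occupied or not a spot. Being occupied means holding a car with a smaller
  number.\<close>

lemma spot_prefs_car_at:
  assumes s: "s \<in> {1..n}"
  shows "spot_prefs n ps (car_at n ps s - 1) =
    {s} \<union> (if s < n \<and> car_at n ps (s + 1) < car_at n ps s then {s + 1} else {}) \<union>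
    (if 2 \<le> s \<and> car_at n ps (s - 1) < car_at n ps s \<and> (s = 2 \<or> car_at n ps (s - 2) < car_at n ps s)
     then {s - 1} else {})" (is "_ = ?R")
proof -
  let ?c = "car_at n ps"
  have b: "1 \<le> ?c s" "?c s \<le> n" using car_at_bounds[OF s] by auto
  have T: "t \<in> set (take (?c s - 1) ps) \<longleftrightarrow> t \<in> {1..n} \<and> ?c t < ?c s" for t
    using mem_take_iff[of "?c s - 1" t] b by auto
  have "a \<in> spot_prefs n ps (?c s - 1) \<longleftrightarrow> a \<in> ?R" for a
  proof -
    have "a \<in> spot_prefs n ps (?c s - 1) \<longleftrightarrow>
        a \<in> {1..n} \<and> vacillating_spot n (set (take (?c s - 1) ps)) a = Some s"
      unfolding spot_prefs_def using nth_car_at[OF s] by simp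
    also have "\<dots> \<longleftrightarrow> a \<in> ?R"
    proof -
      consider "a = s" | "a = s + 1" | "a + 1 = s" | "s \<noteq> a" "s \<noteq> a - 1" "s \<noteq> a + 1"
        by linarith
      then show ?thesis
      proof cases
        case 3
        define S where "S = set (take (?c s - 1) ps)"
        have e: "a - 1 = s - 2" "a + 1 = s" using 3 by auto
        \<comment> \<open>The spot \<open>s\<close> itself is still free. The alternative
          \<open>s - 2 < 1\<close> is the case \<open>s = 2\<close>, where the car has nowhere to
          back up to.\<close>
        have "vacillating_spot n S a = Some s \<longleftrightarrow> a \<in> S \<and> (s - 2 < 1 \<or> s - 2 \<in> S)"
          unfolding vacillating_spot_def e using 3 s T[of s] by (auto simp: S_def)
        moreover have "a = s - 1" using 3 by simp
        ultimately show ?thesis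
          using 3 s T[of a] T[of "s - 2"] unfolding S_def[symmetric] by (cases "s = 2") auto
      next
        case 2
        moreover have "Suc s \<noteq> s - Suc 0" by simp
        ultimately show ?thesis using s T[of s] T[of "s + 1"] by (simp add: vacillating_spot_def)
      next
        case 1
        with s T[of s] show ?thesis by (simp add: vacillating_spot_def)
      next
        case 4
        then have "a \<notin> ?R" by auto
        moreover have "vacillating_spot n (set (take (?c s - 1) ps)) a \<noteq> Some s"
          using 4 by (auto simp: vacillating_spot_def)
        ultimately show ?thesis by blast
      qed
    qed
    finally show ?thesis .
  qed
  then show ?thesis by blast
qed

lemma car_word_permutation: "car_word n ps \<in> permutations_of_set {1..n}"
proof -
  have "set (rev [1..<Suc n]) = {1..n}" by auto
  then show ?thesis
    using bij_car_at unfolding car_word_def permutations_of_set_def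
    by (auto simp: distinct_map bij_betw_def simp del: upt_Suc)
qed

text \<open>Reindexing the product from cars to spots, the last spot gives the factor cut down by
  \<open>C\<close>, and the other spots give \<open>weight i xs\<close>, since car \<open>i\<close>
  stands in the spot after them.\<close>

lemma prod_spot_prefs:
  assumes i: "i \<in> {1..n}" and last: "ps ! (i - 1) = n"
  shows "\<exists>xs. car_word n ps = i # xs \<and>
    (\<Prod>k<n. card (if k = i - 1 then spot_prefs n ps k \<inter> C else spot_prefs n ps k)) =
      card (({n} \<union> (if forward_step i xs then {n - 1} else {})) \<inter> C) * weight i xs"
proof -
  let ?c = "car_at n ps"
  obtain m where m: "n = Suc m" using i by (cases n) auto
  define xs where "xs = map ?c (rev [1..<Suc m])"
  define g where "g k = card (if k = i - 1 then spot_prefs n ps k \<inter> C else spot_prefs n ps k)" for k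
  have cn: "?c n = i" using car_at_nth[of "i - 1"] i last by auto
  have word: "car_word n ps = i # xs" unfolding car_word_def m xs_def using cn m by simp
  have "bij_betw (\<lambda>s. ?c s - 1) {1..n} {..<n}"
  proof -
    have "bij_betw (\<lambda>k. k - 1) {1..n} {..<n}"
      by (rule bij_betw_byWitness[where f' = Suc]) auto
    from bij_betw_trans[OF bij_car_at this] show ?thesis by (simp add: comp_def)
  qed
  then have "(\<Prod>k<n. g k) = (\<Prod>s=1..n. g (?c s - 1))"
    by (rule prod.reindex_bij_betw[symmetric])
  also have "\<dots> = g (i - 1) * (\<Prod>s=1..m. g (?c s - 1))"
    unfolding m using cn m by (simp add: mult.commute)
  also have "(\<Prod>s=1..m. g (?c s - 1)) = weight i xs"
    unfolding xs_def weight_map_rev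
  proof (rule prod.cong)
    fix s assume s: "s \<in> {1..m}"
    \<comment> \<open>Car \<open>i\<close> is in spot \<open>n\<close>, so the restriction to
      \<open>C\<close> does not touch the earlier spots.\<close>
    have "?c s \<noteq> ?c n"
      using inj_onD[OF bij_betw_imp_inj_on[OF bij_car_at], of s n] s m by auto
    then have "?c s - 1 \<noteq> i - 1" using cn car_at_bounds[of s] i s m by auto
    then have "g (?c s - 1) = card (spot_prefs n ps (?c s - 1))" by (simp add: g_def)
    also have "\<dots> = 1 + of_bool ((if s = m then i else ?c (s + 1)) < ?c s) +
        of_bool (2 \<le> s \<and> ?c (s - 1) < ?c s \<and> (s = 2 \<or> ?c (s - 2) < ?c s))"
      using s m cn by (subst spot_prefs_car_at) (auto simp: card_insert_if)
    finally show "g (?c s - 1) = \<dots>" .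
  qed simp
  also have "g (i - 1) = card (({n} \<union> (if forward_step i xs then {n - 1} else {})) \<inter> C)"
  proof -
    have "forward_step i xs \<longleftrightarrow> 2 \<le> n \<and> ?c (n - 1) < i \<and> (n = 2 \<or> ?c (n - 2) < i)"
      unfolding xs_def forward_step_map_rev using m by auto
    then have "spot_prefs n ps (i - 1) = {n} \<union> (if forward_step i xs then {n - 1} else {})"
      using spot_prefs_car_at[of n] cn m by simp
    then show ?thesis by (simp add: g_def)
  qed
  finally show ?thesis using word by (simp add: g_def)
qed

end

lemma inj_on_car_word: "inj_on (car_word n) (permutations_of_set {1..n})"
proof (rule inj_onI)
  fix ps qs assume *: "ps \<in> permutations_of_set {1..n}" "qs \<in> permutations_of_set {1..n}"
    and eq: "car_word n ps = car_word n qs"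
  have c: "car_at n ps s = car_at n qs s" if "s \<in> {1..n}" for s
    using eq that unfolding car_word_def by (auto simp: map_eq_conv simp del: upt_Suc)
  have len: "length ps = n" "length qs = n"
    using length_finite_permutations_of_set[OF *(1)] length_finite_permutations_of_set[OF *(2)] by auto
  show "ps = qs"
  proof (rule nth_equalityI)
    fix k assume "k < length ps"
    then have k: "k < n" using len by simp
    have s: "ps ! k \<in> {1..n}" using bij_nth[OF *(1)] k by (auto simp: bij_betw_def)
    have "car_at n qs (ps ! k) = Suc k" using c[OF s] car_at_nth[OF *(1) k] by simp
    with nth_car_at[OF *(2) s] show "ps ! k = qs ! k" by simp
  qed (simp add: len)
qed

lemma bij_car_word: "bij_betw (car_word n) (permutations_of_set {1..n}) (permutations_of_set {1..n})"
  unfolding bij_betw_def using inj_on_car_word car_word_permutation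
  by (intro conjI endo_inj_surj) auto

section \<open>Deleting the last spot\<close>

text \<open>The increasing map that skips the value \<open>i\<close>: it undoes the renumbering of
  cars after car \<open>i\<close> has been deleted.\<close>

definition lift :: "nat \<Rightarrow> nat \<Rightarrow> nat" where
  "lift i x = (if i \<le> x then Suc x else x)"

lemma lift_less_lift [simp]: "lift i x < lift i y \<longleftrightarrow> x < y"
  by (auto simp: lift_def)

lemma inj_lift: "inj (lift i)"
  by (rule injI) (auto simp: lift_def split: if_splits)

lemma lift_image: "i \<in> {1..Suc m} \<Longrightarrow> lift i ` {1..m} = {1..Suc m} - {i}"
proof (intro equalityI subsetI)
  fix x assume "i \<in> {1..Suc m}" "x \<in> {1..Suc m} - {i}"
  then have "x = lift i (if x < i then x else x - 1) \<and> (if x < i then x else x - 1) \<in> {1..m}"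
    by (auto simp: lift_def)
  then show "x \<in> lift i ` {1..m}" by blast
qed (auto simp: lift_def split: if_splits)

lemma permutations_remove:
  assumes "i \<in> {1..Suc m}"
  shows "permutations_of_set ({1..Suc m} - {i}) = map (lift i) ` permutations_of_set {1..m}"
  using permutations_of_set_image_inj[OF inj_on_subset[OF inj_lift subset_UNIV], of i "{1..m}"]
    lift_image[OF assms] by simp

lemma forward_step_lift [simp]: "forward_step (lift i x) (map (lift i) xs) = forward_step x xs"
  by (cases "(x, xs)" rule: forward_step.cases) auto

text \<open>Weights only compare car numbers, and \<open>lift i\<close> preserves order.\<close>

lemma weight_lift [simp]: "weight (lift i y) (map (lift i) xs) = weight y xs"
  by (induction xs arbitrary: y) (auto simp del: of_bool_eq_iff)

text \<open>A permutation is its first entry \<open>i\<close> followed by a permutation of the other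
  values, renumbered through \<open>lift i\<close>.\<close>

lemma sum_permutations_Suc:
  fixes g :: "nat list \<Rightarrow> 'a::comm_monoid_add"
  shows "(\<Sum>xs\<in>permutations_of_set {1..Suc m}. g xs) =
    (\<Sum>i=1..Suc m. \<Sum>xs\<in>permutations_of_set {1..m}. g (i # map (lift i) xs))"
proof -
  have "(\<Sum>xs\<in>permutations_of_set {1..Suc m}. g xs) =
      (\<Sum>i=1..Suc m. \<Sum>xs\<in>(#) i ` permutations_of_set ({1..Suc m} - {i}). g xs)"
    by (subst permutations_of_set_nonempty, simp, rule sum.UNION_disjoint) auto
  also have "\<dots> = (\<Sum>i=1..Suc m. \<Sum>xs\<in>permutations_of_set {1..m}. g (i # map (lift i) xs))"
  proof (rule sum.cong)
    fix i assume i: "i \<in> {1..Suc m}"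
    have "inj_on ((#) i \<circ> map (lift i)) (permutations_of_set {1..m})"
      using inj_onD[OF inj_mapI[OF inj_lift]] by (auto intro!: inj_onI)
    then show "(\<Sum>xs\<in>(#) i ` permutations_of_set ({1..Suc m} - {i}). g xs) =
        (\<Sum>xs\<in>permutations_of_set {1..m}. g (i # map (lift i) xs))"
      unfolding permutations_remove[OF i] image_comp by (subst sum.reindex) simp_all
  qed simp
  finally show ?thesis .
qed

text \<open>In terms of \<open>car_word\<close>, the condition that car \<open>i\<close> ends in the
  last spot says that the word starts with \<open>i\<close>; its tail is then an arbitrary lifted
  permutation of \<open>{1..m}\<close>.\<close>

lemma card_VPF_restricted_weight:
  assumes i: "i \<in> {1..Suc m}"
  shows "card {\<alpha> \<in> VPF (Suc m). \<alpha> ! (i - 1) \<in> C \<and> parking_spot (Suc m) \<alpha> i = Suc m} =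
    (\<Sum>xs\<in>permutations_of_set {1..m}.
       card (({Suc m} \<union> (if forward_step i (map (lift i) xs) then {m} else {})) \<inter> C) *
       weight i (map (lift i) xs))"
proof -
  define n where "n = Suc m"
  \<comment> \<open>Extending the summand by 0 to words with another head allows reindexing along
    \<open>car_word\<close> over all permutations.\<close>
  define g where "g xs = (if hd xs = i then
    card (({n} \<union> (if forward_step i (tl xs) then {n - 1} else {})) \<inter> C) * weight i (tl xs) else 0)" for xs
  define h where "h ps = (\<Prod>k<n. card (if k = i - 1 then spot_prefs n ps k \<inter> C else spot_prefs n ps k))" for ps
  have "card {\<alpha> \<in> VPF n. \<alpha> ! (i - 1) \<in> C \<and> parking_spot n \<alpha> i = n} =
      (\<Sum>ps\<in>{ps \<in> permutations_of_set {1..n}. ps ! (i - 1) = n}. h ps)"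
    unfolding h_def using i by (intro card_VPF_restricted) (simp add: n_def)
  also have "\<dots> = (\<Sum>ps\<in>permutations_of_set {1..n}. if ps ! (i - 1) = n then h ps else 0)"
    by (rule sum.inter_filter) simp
  also have "\<dots> = (\<Sum>ps\<in>permutations_of_set {1..n}. g (car_word n ps))"
  proof (rule sum.cong)
    fix ps assume ps: "ps \<in> permutations_of_set {1..n}"
    show "(if ps ! (i - 1) = n then h ps else 0) = g (car_word n ps)"
    proof (cases "ps ! (i - 1) = n")
      case True
      obtain xs where "car_word n ps = i # xs"
        "h ps = card (({n} \<union> (if forward_step i xs then {n - 1} else {})) \<inter> C) * weight i xs"
        using prod_spot_prefs[OF ps _ True, of C] i unfolding h_def n_def by blast
      with True show ?thesis by (simp add: g_def)
    next
      case False
      have "hd (car_word n ps) = car_at n ps n" by (simp add: car_word_def n_def)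
      moreover have "car_at n ps n \<noteq> i" using False nth_car_at[OF ps, of n] by (auto simp: n_def)
      ultimately show ?thesis using False by (simp add: g_def)
    qed
  qed simp
  also have "\<dots> = (\<Sum>xs\<in>permutations_of_set {1..n}. g xs)"
    by (rule sum.reindex_bij_betw[OF bij_car_word])
  also have "\<dots> = (\<Sum>j=1..Suc m. if j = i then
      \<Sum>xs\<in>permutations_of_set {1..m}. g (i # map (lift i) xs) else 0)"
    unfolding n_def sum_permutations_Suc by (intro sum.cong) (auto simp: g_def)
  also have "\<dots> = (\<Sum>xs\<in>permutations_of_set {1..m}. g (i # map (lift i) xs))"
    using i by simp
  finally show ?thesis by (simp add: g_def n_def cong: if_cong)
qed

section \<open>Recursions\<close>

lemma finite_VPF [simp]: "finite (VPF n)"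
proof -
  have "VPF n \<subseteq> {xs. set xs \<subseteq> {1..n} \<and> length xs = n}"
    by (auto simp: VPF_def pref_lists_def)
  then show ?thesis by (rule finite_subset) (simp add: finite_lists_length_eq)
qed

lemma card_VPF_0: "card (VPF 0) = 1"
proof -
  have "VPF 0 = {[]}" by (auto simp: VPF_def pref_lists_def outcome_def)
  then show ?thesis by simp
qed

text \<open>The outcome is a permutation, so exactly one car, \<open>car_at n ps n\<close>, occupies
  spot \<open>n\<close>.\<close>

lemma card_VPF_eq_sum_last:
  assumes "1 \<le> n"
  shows "card (VPF n) = (\<Sum>j = 1..n. card (VPF_last n j))"
proof -
  have unique: "\<exists>!j. j \<in> {1..n} \<and> parking_spot n \<alpha> j = n" if \<alpha>: "\<alpha> \<in> VPF n" for \<alpha>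
  proof -
    obtain ps where ps: "outcome n \<alpha> = Some ps" "ps \<in> permutations_of_set {1..n}"
      using \<alpha> outcome_permutation by (auto simp: VPF_def)
    have "j \<in> {1..n} \<and> parking_spot n \<alpha> j = n \<longleftrightarrow> j = car_at n ps n" for j
    proof
      assume "j \<in> {1..n} \<and> parking_spot n \<alpha> j = n"
      then show "j = car_at n ps n"
        using car_at_nth[OF ps(2), of "j - 1"] ps(1) by (auto simp: parking_spot_def)
    next
      assume "j = car_at n ps n"
      then show "j \<in> {1..n} \<and> parking_spot n \<alpha> j = n"
        using car_at_bounds[OF ps(2), of n] nth_car_at[OF ps(2), of n] ps(1) assms
        by (simp add: parking_spot_def)
    qed
    then show ?thesis by simp
  qed
  have "VPF n = (\<Union>j\<in>{1..n}. VPF_last n j)"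
    using unique unfolding VPF_last_def by blast
  also have "card \<dots> = (\<Sum>j = 1..n. card (VPF_last n j))"
  proof (rule card_UN_disjoint)
    show "\<forall>i\<in>{1..n}. \<forall>j\<in>{1..n}. i \<noteq> j \<longrightarrow> VPF_last n i \<inter> VPF_last n j = {}"
      using unique unfolding VPF_last_def by blast
  qed (auto simp: VPF_last_def)
  finally show ?thesis .
qed

section \<open>Cardinalities as sums of weights\<close>

lemma card_VPF_round_weight:
  assumes "i \<in> {1..Suc m}"
  shows "card (VPF_round (Suc m) i) =
    (\<Sum>xs\<in>permutations_of_set {1..m}. weight i (map (lift i) xs))"
  using card_VPF_restricted_weight[OF assms, of "{Suc m}"] by (simp add: VPF_round_def)

lemma card_VPF_square_weight:
  assumes "i \<in> {1..Suc m}"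
  shows "card (VPF_square (Suc m) i) =
    (\<Sum>xs\<in>permutations_of_set {1..m}.
       of_bool (forward_step i (map (lift i) xs)) * weight i (map (lift i) xs))"
proof -
  have "card (({Suc m} \<union> (if P then {m} else {})) \<inter> {m}) = of_bool P" for P by simp
  with card_VPF_restricted_weight[OF assms, of "{m}"] show ?thesis by (simp add: VPF_square_def)
qed

text \<open>The boundary value \<open>Suc (Suc m)\<close> exceeds every car, so the factor of car
  \<open>i\<close> is 1 for preferring the last spot, plus 1 if it can prefer the spot
  before.\<close>

lemma card_VPF_last_weight:
  assumes "i \<in> {1..Suc m}"
  shows "card (VPF_last (Suc m) i) =
    (\<Sum>xs\<in>permutations_of_set {1..m}. weight (Suc (Suc m)) (i # map (lift i) xs))"
proof -
  have "card (({Suc m} \<union> (if P then {m} else {})) \<inter> UNIV) = 1 + of_bool P" for P by simp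
  with card_VPF_restricted_weight[OF assms, of UNIV] assms show ?thesis by (simp add: VPF_last_def)
qed

lemma card_VPF_last_eq:
  assumes "i \<in> {1..n}"
  shows "card (VPF_last n i) = card (VPF_round n i) + card (VPF_square n i)"
proof -
  obtain m where "n = Suc m" using assms by (cases n) auto
  then have i: "i \<in> {1..Suc m}" using assms by simp
  then show ?thesis
    unfolding \<open>n = Suc m\<close> card_VPF_last_weight[OF i] card_VPF_round_weight[OF i]
      card_VPF_square_weight[OF i] sum.distrib[symmetric]
    by (intro sum.cong) auto
qed

lemma sum_hd_weight:
  "(\<Sum>xs\<in>permutations_of_set {1..Suc m}. f (hd xs) * weight (Suc (Suc m)) xs) =
     (\<Sum>j=1..Suc m. f j * card (VPF_last (Suc m) j))"
  unfolding sum_permutations_Suc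
  by (intro sum.cong) (simp_all add: card_VPF_last_weight sum_distrib_left del: weight.simps)

text \<open>Grouping by the car in the last spot and omitting its factor leaves the lists in which
  that car prefers its own spot. In the recursions \<open>f\<close> is an indicator.\<close>

lemma sum_hd_weight_tl:
  "(\<Sum>xs\<in>permutations_of_set {1..Suc m}. f (hd xs) * weight (hd xs) (tl xs)) =
     (\<Sum>j=1..Suc m. f j * card (VPF_round (Suc m) j))"
  unfolding sum_permutations_Suc
  by (intro sum.cong) (simp_all add: card_VPF_round_weight sum_distrib_left)

lemma card_VPF_weight: "card (VPF m) = (\<Sum>xs\<in>permutations_of_set {1..m}. weight (Suc m) xs)"
proof (cases m)
  case 0
  then show ?thesis by (simp add: card_VPF_0)
next
  case (Suc k)
  then show ?thesis
    using sum_hd_weight[of "\<lambda>_. 1" k] card_VPF_eq_sum_last[of m] by simp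
qed

text \<open>Compared with the end of the street, a car \<open>i\<close> behind \<open>xs\<close>
  adds just one option: the head car may prefer the spot of \<open>i\<close>, provided
  \<open>i\<close> came first. After lifting this means \<open>i \<le> hd xs\<close>.\<close>

lemma weight_map_lift:
  assumes "xs \<in> permutations_of_set {1..Suc m}"
  shows "weight i (map (lift i) xs) =
    weight (Suc (Suc m)) xs + of_bool (i \<le> hd xs) * weight (hd xs) (tl xs)"
proof -
  obtain x ys where xs: "xs = x # ys"
    using length_finite_permutations_of_set[OF assms] by (cases xs) auto
  then have "x \<in> {1..Suc m}" using permutations_of_setD(1)[OF assms] by auto
  moreover have "i < lift i x \<longleftrightarrow> i \<le> x" by (auto simp: lift_def)
  ultimately show ?thesis unfolding xs by (simp add: algebra_simps)
qed

lemma card_VPF_round_Suc: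
  assumes "1 \<le> m" "i \<in> {1..Suc m}"
  shows "card (VPF_round (Suc m) i) = card (VPF m) + (\<Sum>j=i..m. card (VPF_round m j))"
proof -
  obtain k where m: "m = Suc k" using assms by (cases m) auto
  have "card (VPF_round (Suc m) i) = card (VPF m) +
      (\<Sum>j=1..m. of_bool (i \<le> j) * card (VPF_round m j))"
    using assms unfolding m card_VPF_weight[of "Suc k"]
    by (simp add: card_VPF_round_weight weight_map_lift sum.distrib
      sum_hd_weight_tl[of "\<lambda>j. of_bool (i \<le> j)", simplified])
  also have "(\<Sum>j=1..m. of_bool (i \<le> j) * card (VPF_round m j)) = (\<Sum>j=i..m. card (VPF_round m j))"
    using assms by (intro sum.mono_neutral_cong_right) auto
  finally show ?thesis .
qed

text \<open>Delete car \<open>i\<close>, then the car \<open>j\<close> from the spot before it. Car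
  \<open>j\<close> must precede \<open>i\<close>, so it cannot have backed up. If it preferred its
  own spot, \<open>weight_map_lift\<close> gives the \<open>VPF_last\<close> and
  \<open>VPF_round\<close> terms; if it moved forward, it gives the \<open>VPF_square\<close>
  term.\<close>

lemma card_VPF_square_Suc_Suc:
  assumes "1 \<le> k" "i \<in> {1..Suc (Suc k)}"
  shows "card (VPF_square (Suc (Suc k)) i) =
    (\<Sum>j=1..i - 1. card (VPF_square (Suc k) j)) + (i - 1) * (\<Sum>l=1..i - 2. card (VPF_last k l)) +
    (\<Sum>l=1..i - 2. l * card (VPF_round k l))"
proof -
  let ?P = "permutations_of_set {1..k}"
  obtain k' where k: "k = Suc k'" using assms by (cases k) auto
  define sq where "sq j ys = of_bool (forward_step j (map (lift j) ys)) * weight j (map (lift j) ys)" for j ys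
  have step: "of_bool (forward_step i (map (lift i) (j # map (lift j) ys))) *
        weight i (map (lift i) (j # map (lift j) ys)) =
      (if j < i then of_bool (hd ys + 1 < i) * weight (Suc k) ys +
         of_bool (hd ys + 1 < i \<and> j \<le> hd ys) * weight (hd ys) (tl ys) + sq j ys else 0)"
    if ys: "ys \<in> ?P" for j ys
  proof -
    obtain y zs where y: "ys = y # zs"
      using length_finite_permutations_of_set[OF ys] k by (cases ys) auto
    let ?u = "map (lift j) ys"
    show ?thesis
    proof (cases "j < i")
      case True
      have "i > lift i j" using True by (simp add: lift_def)
      then have w: "weight i (map (lift i) (j # ?u)) =
          (1 + of_bool (forward_step j ?u)) * weight j ?u" by (simp del: map_map)
      \<comment> \<open>Both deletions are undone here. If \<open>y < j\<close>, both sides hold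
        because \<open>y + 1 \<le> j < i\<close>; otherwise \<open>lift j y = y + 1\<close>.\<close>
      have "lift i (lift j y) < i \<longleftrightarrow> y + 1 < i" using True by (auto simp: lift_def)
      then have f: "forward_step i (map (lift i) (j # ?u)) \<longleftrightarrow> y + 1 < i"
        using \<open>i > lift i j\<close> by (simp add: y)
      have "forward_step j ?u \<Longrightarrow> y + 1 < i"
        using True unfolding y by (cases zs) (auto simp: lift_def split: if_splits)
      then have sq: "of_bool (y + 1 < i) * ((1 + of_bool (forward_step j ?u)) * weight j ?u) =
          of_bool (y + 1 < i) * weight j ?u + sq j ys"
        by (auto simp: sq_def)
      have u: "weight j ?u = weight (Suc k) ys + of_bool (j \<le> y) * weight y zs"
        using weight_map_lift[of ys k' j] ys unfolding k y by simp
      show ?thesis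
        unfolding w f sq unfolding u using True
        by (simp add: y algebra_simps of_bool_conj del: weight.simps)
    next
      case False
      then have "\<not> lift i j < i" by (simp add: lift_def)
      with False show ?thesis by (simp add: y)
    qed
  qed
  have "card (VPF_square (Suc (Suc k)) i) = (\<Sum>j=1..Suc k. \<Sum>ys\<in>?P.
      (if j < i then of_bool (hd ys + 1 < i) * weight (Suc k) ys +
         of_bool (hd ys + 1 < i \<and> j \<le> hd ys) * weight (hd ys) (tl ys) + sq j ys else 0))"
    unfolding card_VPF_square_weight[OF assms(2)] sum_permutations_Suc
    by (intro sum.cong refl step)
  also have "\<dots> = (\<Sum>j=1..i - 1. \<Sum>ys\<in>?P.
      of_bool (hd ys + 1 < i) * weight (Suc k) ys +
         of_bool (hd ys + 1 < i \<and> j \<le> hd ys) * weight (hd ys) (tl ys) + sq j ys)"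
    using assms by (intro sum.mono_neutral_cong_right) auto
  also have "\<dots> = (\<Sum>j=1..i - 1. (\<Sum>l=1..i - 2. card (VPF_last k l)) +
      (\<Sum>l=1..i - 2. of_bool (j \<le> l) * card (VPF_round k l)) + card (VPF_square (Suc k) j))"
  proof (rule sum.cong)
    fix j assume j: "j \<in> {1..i - 1}"
    have "(\<Sum>ys\<in>?P. of_bool (hd ys + 1 < i) * weight (Suc k) ys) =
        (\<Sum>l=1..k. of_bool (l + 1 < i) * card (VPF_last k l))"
      unfolding k by (rule sum_hd_weight)
    also have "\<dots> = (\<Sum>l=1..i - 2. card (VPF_last k l))"
      using assms by (intro sum.mono_neutral_cong_right) auto
    finally have L: "(\<Sum>ys\<in>?P. of_bool (hd ys + 1 < i) * weight (Suc k) ys) = \<dots>" .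
    have "(\<Sum>ys\<in>?P. of_bool (hd ys + 1 < i \<and> j \<le> hd ys) * weight (hd ys) (tl ys)) =
        (\<Sum>l=1..k. of_bool (l + 1 < i \<and> j \<le> l) * card (VPF_round k l))"
      unfolding k by (rule sum_hd_weight_tl)
    also have "\<dots> = (\<Sum>l=1..i - 2. of_bool (j \<le> l) * card (VPF_round k l))"
      using assms by (intro sum.mono_neutral_cong_right) auto
    finally have R: "(\<Sum>ys\<in>?P. of_bool (hd ys + 1 < i \<and> j \<le> hd ys) * weight (hd ys) (tl ys)) = \<dots>" .
    have "(\<Sum>ys\<in>?P. sq j ys) = card (VPF_square (Suc k) j)"
      unfolding sq_def using card_VPF_square_weight[of j k] j assms by auto
    with L R show "(\<Sum>ys\<in>?P. of_bool (hd ys + 1 < i) * weight (Suc k) ys +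
         of_bool (hd ys + 1 < i \<and> j \<le> hd ys) * weight (hd ys) (tl ys) + sq j ys) =
       (\<Sum>l=1..i - 2. card (VPF_last k l)) +
      (\<Sum>l=1..i - 2. of_bool (j \<le> l) * card (VPF_round k l)) + card (VPF_square (Suc k) j)"
      unfolding sum.distrib by simp
  qed simp
  also have "\<dots> = (i - 1) * (\<Sum>l=1..i - 2. card (VPF_last k l)) +
      (\<Sum>j=1..i - 1. \<Sum>l=1..i - 2. of_bool (j \<le> l) * card (VPF_round k l)) +
      (\<Sum>j=1..i - 1. card (VPF_square (Suc k) j))"
    unfolding sum.distrib by simp
  \<comment> \<open>For \<open>l \<le> i - 2\<close> all of \<open>1..l\<close> lies in the range of
    \<open>j\<close>, so each term is counted \<open>l\<close> times.\<close>
  also have "(\<Sum>j=1..i - 1. \<Sum>l=1..i - 2. of_bool (j \<le> l) * card (VPF_round k l)) =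
      (\<Sum>l=1..i - 2. l * card (VPF_round k l))"
  proof (subst sum.swap, rule sum.cong)
    fix l assume l: "l \<in> {1..i - 2}"
    have "(\<Sum>j=1..i - 1. of_bool (j \<le> l) * card (VPF_round k l)) = (\<Sum>j=1..l. card (VPF_round k l))"
      using l by (intro sum.mono_neutral_cong_right) auto
    then show "(\<Sum>j=1..i - 1. of_bool (j \<le> l) * card (VPF_round k l)) = l * card (VPF_round k l)"
      by simp
  qed simp
  finally show ?thesis by simp
qed

section \<open>Applying the first recursion a second time\<close>

lemma sum_tail_swap:
  fixes f g :: "nat \<Rightarrow> real"
  shows "(\<Sum>j=a..b. g j * (\<Sum>l=j..c. f l)) = (\<Sum>l=a..c. (\<Sum>j=a..min b l. g j) * f l)"
proof -
  have "(\<Sum>j=a..b. g j * (\<Sum>l=j..c. f l)) = (\<Sum>j=a..b. \<Sum>l | l \<in> {a..c} \<and> j \<le> l. g j * f l)"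
    unfolding sum_distrib_left by (intro sum.cong) auto
  also have "\<dots> = (\<Sum>l=a..c. \<Sum>j | j \<in> {a..b} \<and> j \<le> l. g j * f l)"
    by (rule sum.swap_restrict) auto
  also have "\<dots> = (\<Sum>l=a..c. (\<Sum>j=a..min b l. g j) * f l)"
    unfolding sum_distrib_right by (intro sum.cong) auto
  finally show ?thesis .
qed

lemma sum_real_upto: "(\<Sum>j=1..n. real j) = real n * (real n + 1) / 2"
  by (induction n) (simp_all add: field_simps)

text \<open>Two applications of \<open>card_VPF_round_Suc\<close>: the outer sum has
  \<open>n - i\<close> terms, and the value at \<open>l\<close> occurs once for each
  \<open>j\<close> in \<open>i..l\<close>.\<close>

lemma card_VPF_round_rec:
  assumes n: "3 \<le> n" and i: "i \<in> {1..n}"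
  shows "real (card (VPF_round n i)) = real (card (VPF (n - 1)))
        + (real n - real i) * real (card (VPF (n - 2)))
        + (\<Sum>l = i..n - 2. (real l + 1 - real i) * real (card (VPF_round (n - 2) l)))"
proof -
  obtain k where k: "n = Suc (Suc k)" "1 \<le> k" using n by (cases n; cases "n - 1") auto
  let ?R = "\<lambda>l. real (card (VPF_round k l))"
  have "real (card (VPF_round n i)) =
      real (card (VPF (Suc k))) + real (\<Sum>j=i..Suc k. card (VPF_round (Suc k) j))"
    using card_VPF_round_Suc[of "Suc k" i] i k by simp
  also have "(\<Sum>j=i..Suc k. card (VPF_round (Suc k) j)) =
      (\<Sum>j=i..Suc k. card (VPF k) + (\<Sum>l=j..k. card (VPF_round k l)))"
    using card_VPF_round_Suc[of k] i k by (intro sum.cong) auto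
  also have "real \<dots> = (real n - real i) * real (card (VPF k)) + (\<Sum>j=i..Suc k. 1 * (\<Sum>l=j..k. ?R l))"
    using i k by (simp add: sum.distrib of_nat_diff)
  also have "(\<Sum>j=i..Suc k. 1 * (\<Sum>l=j..k. ?R l)) = (\<Sum>l=i..k. (real l + 1 - real i) * ?R l)"
    unfolding sum_tail_swap by (intro sum.cong) (auto simp: of_nat_diff)
  finally show ?thesis using k by simp
qed

text \<open>In \<open>card_VPF_square_Suc_Suc\<close>, only the last sum is expanded by
  \<open>card_VPF_round_Suc\<close>. Its weights \<open>l\<close> add up to triangular
  numbers.\<close>

lemma card_VPF_square_rec:
  assumes n: "4 \<le> n" and i: "i \<in> {1..n}"
  shows "real (card (VPF_square n i)) =
          (real i - 1) * (real i - 2) / 2 * real (card (VPF (n - 3)))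
        + (\<Sum>l = 1..i - 1. real (card (VPF_square (n - 1) l)))
        + (real i - 1) * (\<Sum>l = 1..i - 2. real (card (VPF_last (n - 2) l)))
        + (\<Sum>l = 1..i - 3. real l * (real l + 1) / 2 * real (card (VPF_round (n - 3) l)))
        + (real i - 2) * (real i - 1) / 2
            * (\<Sum>l = i - 2..n - 3. real (card (VPF_round (n - 3) l)))"
proof -
  define k where "k = n - 3"
  have k: "n = Suc (Suc (Suc k))" "1 \<le> k" using n by (auto simp: k_def)
  let ?R = "\<lambda>l. real (card (VPF_round k l))"
  have "real (\<Sum>l=1..i - 2. l * card (VPF_round (Suc k) l)) =
      (\<Sum>l=1..i - 2. real l * card (VPF k) + real l * (\<Sum>j=l..k. ?R j))"
    using card_VPF_round_Suc[of k] i k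
    unfolding of_nat_sum by (intro sum.cong) (auto simp: algebra_simps)
  also have "\<dots> = (\<Sum>l=1..i - 2. real l) * card (VPF k) + (\<Sum>l=1..i - 2. real l * (\<Sum>j=l..k. ?R j))"
    by (simp add: sum.distrib sum_distrib_right)
  also have "(\<Sum>l=1..i - 2. real l) = (real i - 1) * (real i - 2) / 2"
  proof (cases "i = 1")
    case False
    with i have "real (i - 2) = real i - 2" by (simp add: of_nat_diff)
    then show ?thesis unfolding sum_real_upto by simp
  qed simp
  also have "(\<Sum>l=1..i - 2. real l * (\<Sum>j=l..k. ?R j)) =
      (\<Sum>l = 1..i - 3. real l * (real l + 1) / 2 * ?R l)
        + (real i - 2) * (real i - 1) / 2 * (\<Sum>l = i - 2..k. ?R l)"
  \<comment> \<open>For \<open>i \<le> 2\<close> the truncated \<open>i - 2\<close> is 0, so the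
    final sum starts at the meaningless index 0; its real coefficient
    \<open>(i - 2) * (i - 1) / 2\<close> vanishes.\<close>
  proof (cases "i \<le> 2")
    case True
    then have "i = 1 \<or> i = 2" using i by auto
    then show ?thesis by auto
  next
    case False
    \<comment> \<open>The split is where \<open>min (i - 2) l\<close> changes from \<open>l\<close>
      to \<open>i - 2\<close>.\<close>
    have "{1..k} = {1..i - 3} \<union> {i - 2..k}" "{1..i - 3} \<inter> {i - 2..k} = {}"
      using False i k by auto
    then have "(\<Sum>l=1..k. (\<Sum>j=1..min (i - 2) l. real j) * ?R l) =
        (\<Sum>l=1..i - 3. (\<Sum>j=1..min (i - 2) l. real j) * ?R l) +
        (\<Sum>l=i - 2..k. (\<Sum>j=1..min (i - 2) l. real j) * ?R l)"
      by (simp add: sum.union_disjoint)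
    also have "(\<Sum>l=1..i - 3. (\<Sum>j=1..min (i - 2) l. real j) * ?R l) =
        (\<Sum>l = 1..i - 3. real l * (real l + 1) / 2 * ?R l)"
      by (intro sum.cong refl) (subst min_absorb2, auto simp: sum_real_upto[simplified])
    also have "(\<Sum>l=i - 2..k. (\<Sum>j=1..min (i - 2) l. real j) * ?R l) =
        (\<Sum>l=i - 2..k. (real i - 2) * (real i - 1) / 2 * ?R l)"
      using False unfolding sum_real_upto
      by (intro sum.cong refl) (simp add: of_nat_diff)
    finally show ?thesis unfolding sum_tail_swap unfolding sum_distrib_left .
  qed
  finally have "real (\<Sum>l=1..i - 2. l * card (VPF_round (Suc k) l)) =
      (real i - 1) * (real i - 2) / 2 * card (VPF k) +
      ((\<Sum>l = 1..i - 3. real l * (real l + 1) / 2 * ?R l)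
        + (real i - 2) * (real i - 1) / 2 * (\<Sum>l = i - 2..k. ?R l))" .
  moreover have "real (i - 1) = real i - 1" using i by (simp add: of_nat_diff)
  ultimately show ?thesis
    using arg_cong[OF card_VPF_square_Suc_Suc[of "Suc k" i], of real] i unfolding k by simp
qed

section \<open>Initial values\<close>

lemma VPF_square_base:
  "card (VPF_square 1 1) = 0" "card (VPF_square 2 1) = 0" "card (VPF_square 2 2) = 1"
  "card (VPF_square 3 1) = 0" "card (VPF_square 3 2) = 0" "card (VPF_square 3 3) = 4"
proof -
  have P1: "permutations_of_set {1..1} = {[1::nat]}" by simp
  have P2: "permutations_of_set {1..2} = {[1, 2], [2, 1::nat]}"
    using permutations_of_set_doubleton[of 1 "2::nat"] by (simp add: atLeastAtMost_insertL[symmetric] numeral_2_eq_2)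
  show "card (VPF_square 1 1) = 0"
    using card_VPF_square_weight[of 1 0] by simp
  show "card (VPF_square 2 1) = 0" "card (VPF_square 2 2) = 1"
    using card_VPF_square_weight[of _ 1] unfolding P1 by (simp_all add: lift_def numeral_2_eq_2)
  show "card (VPF_square 3 1) = 0" "card (VPF_square 3 2) = 0" "card (VPF_square 3 3) = 4"
    using card_VPF_square_weight[of 1 2] card_VPF_square_weight[of 2 2] card_VPF_square_weight[of 3 2]
    unfolding P2 by (simp_all add: lift_def eval_nat_numeral)
qed

text \<open>These follow from \<open>card_VPF_round_Suc\<close>, alternating with the totals
  \<open>card (VPF 1) = 1\<close> and \<open>card (VPF 2) = 4\<close>.\<close>

lemma VPF_round_base:
  "card (VPF_round 1 1) = 1" "card (VPF_round 2 2) = 1" "card (VPF_round 2 1) = 2"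
  "card (VPF_round 3 1) = 7" "card (VPF_round 3 2) = 5" "card (VPF_round 3 3) = 4"
proof -
  show R1: "card (VPF_round 1 1) = 1"
    using card_VPF_round_weight[of 1 0] by simp
  have V1: "card (VPF 1) = 1"
    using R1 VPF_square_base card_VPF_eq_sum_last[of 1] card_VPF_last_eq[of 1 1] by simp
  show R2: "card (VPF_round 2 2) = 1" "card (VPF_round 2 1) = 2"
    using card_VPF_round_Suc[of 1 2] card_VPF_round_Suc[of 1 1] R1 V1
    by (simp_all add: numeral_2_eq_2)
  have V2: "card (VPF 2) = 4"
    using R2 VPF_square_base card_VPF_eq_sum_last[of 2] card_VPF_last_eq[of 1 2] card_VPF_last_eq[of 2 2]
    by (simp add: numeral_2_eq_2)
  have "{1..2} = {1, 2::nat}" "{2..2} = {2::nat}" "{3..2} = ({} :: nat set)" by auto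
  then show "card (VPF_round 3 1) = 7" "card (VPF_round 3 2) = 5" "card (VPF_round 3 3) = 4"
    using card_VPF_round_Suc[of 2 1] card_VPF_round_Suc[of 2 2] card_VPF_round_Suc[of 2 3] R2 V2
    by simp_all
qed

theorem theorem2p1:
  shows "(\<forall>n::nat. \<forall>i::nat. 4 \<le> n \<longrightarrow> i \<in> {1..n} \<longrightarrow>
      card (VPF n) = (\<Sum>j = 1..n. card (VPF_last n j))
    \<and> card (VPF_last n i) = card (VPF_round n i) + card (VPF_square n i)
    \<and> real (card (VPF_round n i)) =
          real (card (VPF (n - 1)))
        + (real n - real i) * real (card (VPF (n - 2)))
        + (\<Sum>l = i..n - 2. (real l + 1 - real i) * real (card (VPF_round (n - 2) l)))
    \<and> real (card (VPF_square n i)) =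
          (real i - 1) * (real i - 2) / 2 * real (card (VPF (n - 3)))
        + (\<Sum>l = 1..i - 1. real (card (VPF_square (n - 1) l)))
        + (real i - 1) * (\<Sum>l = 1..i - 2. real (card (VPF_last (n - 2) l)))
        + (\<Sum>l = 1..i - 3. real l * (real l + 1) / 2 * real (card (VPF_round (n - 3) l)))
        + (real i - 2) * (real i - 1) / 2
            * (\<Sum>l = i - 2..n - 3. real (card (VPF_round (n - 3) l))))
    \<and> card (VPF_round 1 1) = 1 \<and> card (VPF_round 2 2) = 1 \<and> card (VPF_round 2 1) = 2
    \<and> card (VPF_round 3 1) = 7 \<and> card (VPF_round 3 2) = 5 \<and> card (VPF_round 3 3) = 4
    \<and> card (VPF_square 1 1) = 0 \<and> card (VPF_square 2 1) = 0
    \<and> card (VPF_square 3 1) = 0 \<and> card (VPF_square 3 2) = 0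
    \<and> card (VPF_square 2 2) = 1 \<and> card (VPF_square 3 3) = 4"
  using card_VPF_eq_sum_last card_VPF_last_eq card_VPF_round_rec card_VPF_square_rec
    VPF_round_base VPF_square_base
  by simp

end
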